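(* Let $G$ be an $\alpha$-weakly-Helly graph. For every $M\subseteq V(G)$, every vertex $x\in V(G)$ satisfies $$d_G(x,C_G^{\alpha}(M))+rad_G(M)-\alpha\ \le\ e_G^M(x)\ \le\ d_G(x,C_G^{\alpha}(M))+rad_G(M)+\alpha.$$
   Context: All graphs are finite, simple, undirected, unweighted and connected. A graph $G$ is $\alpha$-weakly-Helly if for every family of pairwise intersecting disks $\{D_G(v,r(v)) : v\in S\}$ (where $D_G(v,r)=\{u: d_G(u,v)\le r\}$) the disks $D_G(v,r(v)+\alpha)$, $v\in S$, have a common vertex. For $M\subseteq V(G)$ and $v\in V(G)$: $e_G^M(v)=\max_{u\in M}d_G(v,u)$, $rad_G(M)=\min_{v\in V(G)}e_G^M(v)$, $C_G^{\ell}(M)=\{v: e_G^M(v)\le rad_G(M)+\ell\}$, and $d_G(x,S)=\min_{s\in S}d_G(x,s)$. *)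

theory Defs
  imports "Graph_Theory.Graph_Theory"
begin

(* A finite simple undirected graph is a symmetric digraph without loops and parallel arcs
   (locale graph of Graph_Theory): an edge uv is the pair of opposite arcs, so walks may use
   it in both directions. *)

definition graph_dist :: "('a, 'b) pre_digraph \<Rightarrow> 'a \<Rightarrow> 'a \<Rightarrow> nat" where
  "graph_dist G u v = (LEAST n. \<exists>p. pre_digraph.awalk G u p v \<and> length p = n)"

(* The natural-number valued distance is the library's shortest-path distance with unit weights. *)
lemma (in wf_digraph) graph_dist_eq_shortest_path:
  assumes "u \<rightarrow>\<^sup>* v"
  shows "ereal (real (graph_dist G u v)) = \<mu> (\<lambda>_. 1) u v"
proof -
  have ex: "\<exists>n p. awalk u p v \<and> length p = n"
    using assms by (auto simp: reachable_awalk)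
  obtain p where p: "awalk u p v" "length p = graph_dist G u v"
    using LeastI_ex[OF ex] unfolding graph_dist_def by blast
  have cost: "awalk_cost (\<lambda>_. 1) q = real (length q)" for q :: "'b awalk"
    by (induction q) auto
  have le: "graph_dist G u v \<le> length q" if "awalk u q v" for q
    unfolding graph_dist_def by (rule Least_le) (use that in blast)
  show ?thesis
    unfolding \<mu>_def cost
  proof (rule antisym)
    show "ereal (real (graph_dist G u v)) \<le> (INF q\<in>{q. awalk u q v}. ereal (real (length q)))"
      by (rule INF_greatest) (use le in auto)
    show "(INF q\<in>{q. awalk u q v}. ereal (real (length q))) \<le> ereal (real (graph_dist G u v))"
      by (rule INF_lower2[of p]) (use p in auto)
  qed
qed

definition disk :: "('a, 'b) pre_digraph \<Rightarrow> 'a \<Rightarrow> nat \<Rightarrow> 'a set" where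
  "disk G v r = {u \<in> verts G. graph_dist G u v \<le> r}"

definition weakly_Helly :: "nat \<Rightarrow> ('a, 'b) pre_digraph \<Rightarrow> bool" where
  "weakly_Helly \<alpha> G \<longleftrightarrow>
     (\<forall>S r. S \<subseteq> verts G \<longrightarrow>
        (\<forall>u\<in>S. \<forall>v\<in>S. disk G u (r u) \<inter> disk G v (r v) \<noteq> {}) \<longrightarrow>
        (\<exists>c\<in>verts G. \<forall>v\<in>S. c \<in> disk G v (r v + \<alpha>)))"

(* On finite nonempty sets of naturals Sup is Max; in addition Sup {} = 0, which fixes the
   eccentricity with respect to the empty set. *)
definition ecc :: "('a, 'b) pre_digraph \<Rightarrow> 'a set \<Rightarrow> 'a \<Rightarrow> nat" where
  "ecc G M v = (SUP u\<in>M. graph_dist G v u)"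

definition rad :: "('a, 'b) pre_digraph \<Rightarrow> 'a set \<Rightarrow> nat" where
  "rad G M = Min (ecc G M ` verts G)"

definition center :: "('a, 'b) pre_digraph \<Rightarrow> nat \<Rightarrow> 'a set \<Rightarrow> 'a set" where
  "center G l M = {v \<in> verts G. ecc G M v \<le> rad G M + l}"

definition set_dist :: "('a, 'b) pre_digraph \<Rightarrow> 'a \<Rightarrow> 'a set \<Rightarrow> nat" where
  "set_dist G x S = Min (graph_dist G x ` S)"

end

theory Submission
  imports Defs
begin

text \<open>
  Write \<open>R\<close> for the radius and \<open>e\<close> for the eccentricity of \<open>x\<close>. The upper bound is the triangle
  inequality through a point of the center nearest to \<open>x\<close>. For the lower bound, the disks of radius
  \<open>R\<close> around the points of \<open>M\<close> together with the disk of radius \<open>e - R\<close> around \<open>x\<close> pairwise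
  intersect: the former all contain every vertex of eccentricity \<open>R\<close>, and the latter meets each of
  them because \<open>d(x, v) \<le> e = (e - R) + R\<close>. Enlarging all radii by \<open>\<alpha>\<close> yields a common vertex,
  which lies in the center and within distance \<open>e - R + \<alpha>\<close> of \<open>x\<close>.
\<close>

section \<open>Distance as a metric on the vertices\<close>

lemma (in wf_digraph) graph_dist_le_length:
  "awalk u p v \<Longrightarrow> graph_dist G u v \<le> length p"
  unfolding graph_dist_def by (rule Least_le) (rule exI[of _ p], simp)

lemma (in wf_digraph) shortest_awalk:
  assumes "u \<rightarrow>\<^sup>* v"
  obtains p where "awalk u p v" "length p = graph_dist G u v"
proof -
  have "\<exists>n p. awalk u p v \<and> length p = n"
    using assms by (auto simp: reachable_awalk)
  from LeastI_ex[OF this] have "\<exists>p. awalk u p v \<and> length p = graph_dist G u v"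
    unfolding graph_dist_def .
  then show thesis
    by (elim exE conjE) (rule that)
qed

lemma (in wf_digraph) graph_dist_self [simp]:
  "u \<in> verts G \<Longrightarrow> graph_dist G u u = 0"
  using graph_dist_le_length[of u "[]" u] by (simp add: awalk_Nil_iff)

lemma (in wf_digraph) graph_dist_triangle:
  assumes "u \<rightarrow>\<^sup>* v" "v \<rightarrow>\<^sup>* w"
  shows "graph_dist G u w \<le> graph_dist G u v + graph_dist G v w"
proof -
  obtain p where p: "awalk u p v" "length p = graph_dist G u v"
    using assms(1) by (rule shortest_awalk)
  obtain q where q: "awalk v q w" "length q = graph_dist G v w"
    using assms(2) by (rule shortest_awalk)
  have "awalk u (p @ q) w"
    using p q by (simp add: awalk_appendI)
  from graph_dist_le_length[OF this] show ?thesis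
    by (simp add: p q)
qed

text \<open>Cut a shortest walk after \<open>a\<close> arcs; if it is shorter than that, the cut is
  at \<open>v\<close> itself. This is what makes two disks meet when their radii add up to at least
  the distance of their centres.\<close>

lemma (in wf_digraph) graph_dist_split:
  assumes "u \<rightarrow>\<^sup>* v" "graph_dist G u v \<le> a + b"
  obtains w where "w \<in> verts G" "graph_dist G u w \<le> a" "graph_dist G w v \<le> b"
proof -
  obtain p where p: "awalk u p v" "length p = graph_dist G u v"
    using assms(1) by (rule shortest_awalk)
  have "awalk u (take a p @ drop a p) v"
    using p by (simp only: append_take_drop_id)
  then obtain w where w: "awalk u (take a p) w" "awalk w (drop a p) v"
    unfolding awalk_append_iff by blast
  have "w \<in> verts G"
    using w(2) by (simp add: awalk_def)
  moreover have "graph_dist G u w \<le> a"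
    using graph_dist_le_length[OF w(1)] by simp
  moreover have "graph_dist G w v \<le> b"
    using graph_dist_le_length[OF w(2)] p assms(2) by simp
  ultimately show thesis
    by (rule that)
qed

text \<open>Each arc is replaced by an opposite one, taken in reverse order.\<close>

lemma (in sym_digraph) awalk_reverse:
  "awalk u p v \<Longrightarrow> \<exists>q. awalk v q u \<and> length q = length p"
proof (induction p arbitrary: u)
  case Nil
  then show ?case by (auto simp: awalk_Nil_iff)
next
  case (Cons a p)
  then have a: "a \<in> arcs G" "tail G a = u" and p: "awalk (head G a) p v"
    by (auto simp: awalk_Cons_iff)
  obtain q where q: "awalk v q (head G a)" "length q = length p"
    using Cons.IH[OF p] by blast
  obtain b where "b \<in> arcs G" "tail G b = head G a" "head G b = tail G a"
    using sym_arcs a(1) unfolding symmetric_conv by metis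
  with a(2) have "awalk (head G a) [b] u"
    using arc_implies_awalk[of b] by simp
  with q(1) have "awalk v (q @ [b]) u"
    by (rule awalk_appendI)
  with q(2) show ?case
    by (intro exI[of _ "q @ [b]"]) simp
qed

lemma (in sym_digraph) graph_dist_commute:
  "graph_dist G u v = graph_dist G v u"
proof -
  have "(\<exists>p. awalk u p v \<and> length p = n) \<longleftrightarrow> (\<exists>p. awalk v p u \<and> length p = n)" for n
    by (metis awalk_reverse)
  then show ?thesis
    unfolding graph_dist_def by simp
qed

section \<open>Eccentricity, radius and centre\<close>

lemma (in fin_digraph)
  assumes "M \<subseteq> verts G"
  shows graph_dist_le_ecc: "v \<in> M \<Longrightarrow> graph_dist G x v \<le> ecc G M x"
    and ecc_le: "(\<And>v. v \<in> M \<Longrightarrow> graph_dist G x v \<le> k) \<Longrightarrow> ecc G M x \<le> k"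
proof -
  have fin: "finite (graph_dist G x ` M)"
    by (intro finite_imageI finite_subset[OF assms]) simp
  show "graph_dist G x v \<le> ecc G M x" if "v \<in> M"
    unfolding ecc_def using that fin by (simp add: bdd_above_nat cSUP_upper)
  show "ecc G M x \<le> k" if "\<And>v. v \<in> M \<Longrightarrow> graph_dist G x v \<le> k"
    \<comment> \<open>For empty \<open>M\<close> the bound holds because the supremum of the empty
      set of naturals is 0; \<open>cSUP_least\<close> covers only nonempty sets.\<close>
    unfolding ecc_def using that by (cases "M = {}") (auto intro: cSUP_least)
qed

lemma (in fin_digraph) rad_le_ecc:
  "v \<in> verts G \<Longrightarrow> rad G M \<le> ecc G M v"
  unfolding rad_def by simp

lemma (in fin_digraph) ecc_eq_rad_ex:
  assumes "verts G \<noteq> {}"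
  obtains c where "c \<in> verts G" "ecc G M c = rad G M"
proof -
  have "rad G M \<in> ecc G M ` verts G"
    unfolding rad_def using assms by (intro Min_in) auto
  then show thesis
    using that by auto
qed

lemma center_subset: "center G l M \<subseteq> verts G"
  by (auto simp: center_def)

text \<open>Ensures that the \<open>Min\<close> in the distance to the centre is taken over a
  nonempty set.\<close>

lemma (in fin_digraph) center_nonempty:
  assumes "verts G \<noteq> {}"
  shows "center G l M \<noteq> {}"
proof -
  obtain c where "c \<in> verts G" "ecc G M c = rad G M"
    using assms by (rule ecc_eq_rad_ex)
  then have "c \<in> center G l M"
    by (simp add: center_def)
  then show ?thesis by blast
qed

lemma (in fin_digraph)
  assumes "S \<subseteq> verts G"
  shows set_dist_le: "s \<in> S \<Longrightarrow> set_dist G x S \<le> graph_dist G x s"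
    and set_dist_attained: "S \<noteq> {} \<Longrightarrow> \<exists>s\<in>S. set_dist G x S = graph_dist G x s"
proof -
  have fin: "finite (graph_dist G x ` S)"
    by (intro finite_imageI finite_subset[OF assms]) simp
  show "set_dist G x S \<le> graph_dist G x s" if "s \<in> S"
    unfolding set_dist_def using fin that by simp
  show "\<exists>s\<in>S. set_dist G x S = graph_dist G x s" if "S \<noteq> {}"
    unfolding set_dist_def using Min_in[OF fin] that by auto
qed

section \<open>The upper and the lower bound\<close>

context graph
begin

text \<open>Connectedness is defined through the symmetric closure; since the arcs are already
  symmetric, it yields a walk between any two vertices.\<close>

lemma reachable_verts:
  assumes "Digraph_Component.connected G" "u \<in> verts G" "v \<in> verts G"
  shows "u \<rightarrow>\<^sup>* v"
  using assms symmetric_connected_imp_strongly_connected[OF sym_arcs]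
  by (auto simp: strongly_connected_def)

lemma ecc_le_set_dist_center:
  assumes conn: "Digraph_Component.connected G" and M: "M \<subseteq> verts G" and x: "x \<in> verts G"
  shows "ecc G M x \<le> set_dist G x (center G l M) + rad G M + l"
proof -
  obtain c where c: "c \<in> center G l M" "set_dist G x (center G l M) = graph_dist G x c"
    using set_dist_attained[OF center_subset center_nonempty] x by blast
  have cv: "c \<in> verts G" and ec: "ecc G M c \<le> rad G M + l"
    using c(1) by (auto simp: center_def)
  have "graph_dist G x v \<le> graph_dist G x c + (rad G M + l)" if "v \<in> M" for v
  proof -
    have "graph_dist G x v \<le> graph_dist G x c + graph_dist G c v"
      using that M x cv by (intro graph_dist_triangle reachable_verts[OF conn]) auto
    with graph_dist_le_ecc[OF M that, of c] ec show ?thesis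
      by linarith
  qed
  from ecc_le[OF M this] show ?thesis
    by (simp add: c(2) add.assoc)
qed

text \<open>The summand \<open>\<alpha>\<close> stands on the right because subtraction on naturals
  truncates.\<close>

lemma set_dist_center_le:
  assumes conn: "Digraph_Component.connected G" and helly: "weakly_Helly \<alpha> G"
    and M: "M \<subseteq> verts G" and x: "x \<in> verts G"
  shows "set_dist G x (center G \<alpha> M) + rad G M \<le> ecc G M x + \<alpha>"
proof -
  define R where "R = rad G M"
  define e where "e = ecc G M x"
  \<comment> \<open>Guarantees that \<open>e - R\<close> is not truncated, so that
    \<open>(e - R) + R = e\<close>.\<close>
  have Re: "R \<le> e"
    unfolding R_def e_def by (rule rad_le_ecc[OF x])
  \<comment> \<open>A family of disks has one radius per vertex, so if \<open>x \<in> M\<close> the two disks around \<open>x\<close> are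
    replaced by the smaller one.\<close>
  define r where "r v = (if v \<noteq> x then R else if x \<in> M then min R (e - R) else e - R)" for v
  \<comment> \<open>Smaller radii only sharpen what the common vertex satisfies, so upper bounds
    suffice once the Helly property has been applied.\<close>
  have rx: "r x \<le> e - R" and rM: "v \<in> M \<Longrightarrow> r v \<le> R" for v
    by (auto simp: r_def)
  obtain c0 where c0: "c0 \<in> verts G" "ecc G M c0 = R"
    using ecc_eq_rad_ex[of M] x unfolding R_def by blast
  have c0_disk: "c0 \<in> disk G v R" if "v \<in> M" for v
    using graph_dist_le_ecc[OF M that, of c0] c0
    by (simp add: disk_def)
  have x_disk: "disk G x (e - R) \<inter> disk G v R \<noteq> {}" if "v \<in> M" for v
  proof -
    have "x \<rightarrow>\<^sup>* v"
      using that M x by (intro reachable_verts[OF conn]) auto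
    moreover have "graph_dist G x v \<le> (e - R) + R"
      using graph_dist_le_ecc[OF M that, of x] Re by (simp add: e_def)
    ultimately obtain w where "w \<in> verts G" "graph_dist G x w \<le> e - R" "graph_dist G w v \<le> R"
      by (rule graph_dist_split)
    \<comment> \<open>\<open>disk\<close> measures from the member to the centre, so the distance
      from \<open>x\<close> to \<open>w\<close> has to be reversed.\<close>
    then have "w \<in> disk G x (e - R) \<inter> disk G v R"
      by (simp add: disk_def graph_dist_commute[of x w])
    then show ?thesis by blast
  qed
  have x_self: "x \<in> disk G x k" for k
    using x by (simp add: disk_def)
  have x_meets: "disk G x (r x) \<inter> disk G v (r v) \<noteq> {}" if "v \<in> insert x M" for v
  proof (cases "v = x")
    case True
    then show ?thesis
      using x_self by blast
  next
    case False
    then have v: "v \<in> M" "r v = R"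
      using that by (auto simp: r_def)
    \<comment> \<open>Either the disk around \<open>x\<close> has its intended radius and
      \<open>x_disk\<close> applies, or the minimum is \<open>R\<close> with \<open>x\<close> in
      \<open>M\<close>, and then \<open>c0\<close> lies in both disks.\<close>
    have "r x = e - R \<or> x \<in> M \<and> r x = R"
      by (auto simp: r_def min_def)
    then show ?thesis
    proof (elim disjE conjE)
      assume "r x = e - R"
      then show ?thesis
        using x_disk[OF v(1)] v(2) by simp
    next
      assume "x \<in> M" "r x = R"
      then show ?thesis
        using c0_disk[of x] c0_disk[OF v(1)] v(2) by auto
    qed
  qed
  have "\<forall>u\<in>insert x M. \<forall>v\<in>insert x M. disk G u (r u) \<inter> disk G v (r v) \<noteq> {}"
  proof (intro ballI)
    fix u v
    assume uv: "u \<in> insert x M" "v \<in> insert x M"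
    show "disk G u (r u) \<inter> disk G v (r v) \<noteq> {}"
    proof (cases "u = x \<or> v = x")
      case True
      then show ?thesis
        using x_meets uv by blast
    next
      case False
      then have "c0 \<in> disk G u (r u)" "c0 \<in> disk G v (r v)"
        using uv c0_disk by (auto simp: r_def)
      then show ?thesis by blast
    qed
  qed
  moreover have "insert x M \<subseteq> verts G"
    using M x by simp
  ultimately obtain c where cv: "c \<in> verts G"
    and c: "\<forall>v\<in>insert x M. c \<in> disk G v (r v + \<alpha>)"
    using helly unfolding weakly_Helly_def by meson
  have "graph_dist G c v \<le> R + \<alpha>" if "v \<in> M" for v
  proof -
    have "graph_dist G c v \<le> r v + \<alpha>"
      using c that by (simp add: disk_def)
    with rM[OF that] show ?thesis
      by linarith
  qed
  from ecc_le[OF M this] have "c \<in> center G \<alpha> M"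
    using cv by (simp add: center_def R_def)
  then have "set_dist G x (center G \<alpha> M) \<le> graph_dist G x c"
    by (rule set_dist_le[OF center_subset])
  moreover have "graph_dist G x c \<le> r x + \<alpha>"
    using c by (simp add: disk_def graph_dist_commute[of x c])
  ultimately show ?thesis
    using Re rx unfolding e_def R_def by linarith
qed

end

theorem theorem5:
  fixes G :: "('a, 'b) pre_digraph" and \<alpha> :: nat
  assumes "graph G"
    and "Digraph_Component.connected G"
    and "weakly_Helly \<alpha> G"
  shows "\<forall>M. M \<subseteq> verts G \<longrightarrow> (\<forall>x\<in>verts G.
    int (set_dist G x (center G \<alpha> M)) + int (rad G M) - int \<alpha> \<le> int (ecc G M x) \<and>
    int (ecc G M x) \<le> int (set_dist G x (center G \<alpha> M)) + int (rad G M) + int \<alpha>)"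
proof (intro allI impI ballI)
  fix M x
  assume M: "M \<subseteq> verts G" and x: "x \<in> verts G"
  interpret graph G
    by (rule assms(1))
  show "int (set_dist G x (center G \<alpha> M)) + int (rad G M) - int \<alpha> \<le> int (ecc G M x) \<and>
    int (ecc G M x) \<le> int (set_dist G x (center G \<alpha> M)) + int (rad G M) + int \<alpha>"
    using set_dist_center_le[OF assms(2,3) M x] ecc_le_set_dist_center[OF assms(2) M x, of \<alpha>]
    by linarith
qed

end
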